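(* Let $l$ be a positive integer and let $n$ be a positive integer that is a multiple of $l+1$. Let $D_l(n)$ denote the maximum number of pairwise non-intersecting (positive) $l$-diagonals that can be placed in an $n\times n$ square array. Then $$D_l(n)=\frac{n^2-n(l-2)}{l+1}.$$
   Context: An $n$-array is an $n\times n$ square array of unit squares; its lattice points are the corners of the unit squares, i.e. the points $(x,y)$ with $x,y\in\{0,1,\dots,n\}$. Only positive diagonals (slope $+1$) are considered. A 1-diagonal is the diagonal of positive slope of a unit square, i.e. the segment from $(x,y)$ to $(x+1,y+1)$ with $0\le x,y\le n-1$. An $l$-diagonal is the straight segment made up of the 1-diagonals of $l$ consecutive unit squares in which adjacent squares share exactly one lattice point and the segment passes through these common lattice points; thus it is the segment from $(x,y)$ to $(x+l,y+l)$ with $0\le x,y\le n-l$, containing the $l+1$ lattice points $(x+i,y+i)$, $0\le i\le l$. Two 1-diagonals intersect if they share a common lattice point (including an endpoint) or belong to the same unit square. Two $l$-diagonals intersect if any of the 1-diagonals forming one intersects any of the 1-diagonals forming the other. *)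

theory Defs
  imports Complex_Main
begin

type_synonym point = "nat \<times> nat"

text \<open>A unit square is represented by its four corners, a 1-diagonal by its two endpoints, and
  an \<open>l\<close>-diagonal by the set of the 1-diagonals it consists of.\<close>

definition unit_square :: "nat \<Rightarrow> nat \<Rightarrow> point set" where
  "unit_square x y = {(x, y), (x + 1, y), (x, y + 1), (x + 1, y + 1)}"

definition one_diagonal :: "nat \<Rightarrow> nat \<Rightarrow> point set" where
  "one_diagonal x y = {(x, y), (x + 1, y + 1)}"

definition one_diagonals_intersect :: "point set \<Rightarrow> point set \<Rightarrow> bool" where
  "one_diagonals_intersect d e \<longleftrightarrow>
     d \<inter> e \<noteq> {} \<or> (\<exists>x y. d \<subseteq> unit_square x y \<and> e \<subseteq> unit_square x y)"

definition l_diagonal :: "nat \<Rightarrow> nat \<Rightarrow> nat \<Rightarrow> point set set" where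
  "l_diagonal l x y = {one_diagonal (x + i) (y + i) | i. i < l}"

definition l_diagonals :: "nat \<Rightarrow> nat \<Rightarrow> point set set set" where
  "l_diagonals l n = {l_diagonal l x y | x y. x + l \<le> n \<and> y + l \<le> n}"

definition l_diagonals_intersect :: "point set set \<Rightarrow> point set set \<Rightarrow> bool" where
  "l_diagonals_intersect P Q \<longleftrightarrow> (\<exists>d\<in>P. \<exists>e\<in>Q. one_diagonals_intersect d e)"

definition non_intersecting_families :: "nat \<Rightarrow> nat \<Rightarrow> point set set set set" where
  "non_intersecting_families l n =
     {F. F \<subseteq> l_diagonals l n \<and> pairwise (\<lambda>P Q. \<not> l_diagonals_intersect P Q) F}"

definition max_diagonals :: "nat \<Rightarrow> nat \<Rightarrow> nat" where
  "max_diagonals l n = Max (card ` non_intersecting_families l n)"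

end

theory Submission
  imports Defs
begin

text \<open>
  Two positive \<open>l\<close>-diagonals intersect iff they share a lattice point. Sliding every diagonal
  of a non-intersecting family down along its line until its starting point \<open>(x, y)\<close> satisfies
  \<open>(l + 1) dvd min x y\<close> moves it by at most \<open>l\<close>, hence never merges two of its members. The
  diagonals starting at such points are themselves pairwise non-intersecting, so the maximum is
  the number of these starting points; they are counted according to the value of \<open>min x y\<close>.
\<close>

lemma one_diagonal_subset_unit_square:
  "one_diagonal a b \<subseteq> unit_square x y \<longleftrightarrow> a = x \<and> b = y"
  by (auto simp: one_diagonal_def unit_square_def)

text \<open>A unit square contains a single 1-diagonal of positive slope, so two of them inside the
  same square coincide and share endpoints.\<close>

lemma one_diagonals_intersect_iff:
  "one_diagonals_intersect (one_diagonal a b) (one_diagonal c d) \<longleftrightarrow>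
     one_diagonal a b \<inter> one_diagonal c d \<noteq> {}"
  unfolding one_diagonals_intersect_def one_diagonal_subset_unit_square
  by (auto simp: one_diagonal_def)

lemma l_diagonals_intersect_iff:
  assumes "l > 0"
  shows "l_diagonals_intersect (l_diagonal l x y) (l_diagonal l x' y') \<longleftrightarrow>
    (\<exists>i\<le>l. \<exists>j\<le>l. x + i = x' + j \<and> y + i = y' + j)" (is "?L \<longleftrightarrow> ?R")
proof
  assume ?L
  then obtain i j where ij: "i < l" "j < l"
    and "one_diagonal (x + i) (y + i) \<inter> one_diagonal (x' + j) (y' + j) \<noteq> {}"
    by (auto simp: l_diagonals_intersect_def l_diagonal_def one_diagonals_intersect_iff)
  then obtain i' j' where "i' \<in> {i, i + 1}" "j' \<in> {j, j + 1}" "x + i' = x' + j'" "y + i' = y' + j'"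
    unfolding one_diagonal_def by force
  with ij have "i' \<le> l" "j' \<le> l" "x + i' = x' + j'" "y + i' = y' + j'" by auto
  then show ?R by blast
next
  \<comment> \<open>Each lattice point is the lower end of its own 1-diagonal, except the last one
    (\<open>i = l\<close>), which is the upper end of number \<open>l - 1\<close>.\<close>
  have cover: "\<exists>k<l. (u + i, v + i) \<in> one_diagonal (u + k) (v + k)" if "i \<le> l" for i u v
  proof (cases "i < l")
    case True
    then show ?thesis by (auto simp: one_diagonal_def)
  next
    case False
    with that assms show ?thesis
      by (intro exI[of _ "l - 1"]) (auto simp: one_diagonal_def)
  qed
  assume ?R
  then obtain i j where ij: "i \<le> l" "j \<le> l" "x + i = x' + j" "y + i = y' + j" by blast
  from cover[OF ij(1), of x y] cover[OF ij(2), of x' y'] obtain k k'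
    where "k < l" "(x + i, y + i) \<in> one_diagonal (x + k) (y + k)"
      and "k' < l" "(x + i, y + i) \<in> one_diagonal (x' + k') (y' + k')"
    unfolding ij(3,4) by blast
  then show ?L
    unfolding l_diagonals_intersect_def l_diagonal_def
    by (blast intro: one_diagonals_intersect_iff[THEN iffD2])
qed

definition starts :: "nat \<Rightarrow> nat \<Rightarrow> point set" where
  "starts l n = {(x, y). x + l \<le> n \<and> y + l \<le> n}"

text \<open>\<open>min x y\<close> is the position of (x, y) on its line of slope 1, counted from
  where the line enters the array. Aligned starts on a line are thus l + 1 apart, the number of
  lattice points of an l-diagonal.\<close>

definition aligned_starts :: "nat \<Rightarrow> nat \<Rightarrow> point set" where
  "aligned_starts l n = {(x, y) \<in> starts l n. (l + 1) dvd min x y}"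

definition l_diagonal_from :: "nat \<Rightarrow> point \<Rightarrow> point set set" where
  "l_diagonal_from l p = l_diagonal l (fst p) (snd p)"

text \<open>Both coordinates lose the same amount, at most \<open>min x y\<close>, so the truncated
  subtractions are exact and the point stays on its line.\<close>

definition align :: "nat \<Rightarrow> point \<Rightarrow> point" where
  "align l = (\<lambda>(x, y). (x - min x y mod (l + 1), y - min x y mod (l + 1)))"

lemma finite_starts: "finite (starts l n)"
  by (rule finite_subset[of _ "{..n} \<times> {..n}"]) (auto simp: starts_def)

lemma finite_aligned_starts: "finite (aligned_starts l n)"
  by (rule finite_subset[OF _ finite_starts]) (auto simp: aligned_starts_def)

lemma l_diagonals_eq_image: "l_diagonals l n = l_diagonal_from l ` starts l n"
  unfolding l_diagonals_def starts_def l_diagonal_from_def image_def by force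

lemma align_in_aligned_starts:
  assumes "p \<in> starts l n"
  shows "align l p \<in> aligned_starts l n"
proof -
  obtain x y where p: "p = (x, y)" by (cases p)
  have "min (x - k) (y - k) = min x y - k" for k by (simp add: min_def)
  then have "(l + 1) dvd min (x - min x y mod (l + 1)) (y - min x y mod (l + 1))"
    by (metis dvd_minus_mod)
  with assms show ?thesis
    by (auto simp: p align_def aligned_starts_def starts_def)
qed

text \<open>If p and q slide to the same point by i and j steps, then going up j steps from p and i
  steps from q reaches one common point. As i, j \<le> l, it lies on both diagonals.\<close>

lemma align_eq_imp_intersect:
  assumes "l > 0" and "align l p = align l q"
  shows "l_diagonals_intersect (l_diagonal_from l p) (l_diagonal_from l q)"
proof -
  obtain x y x' y' where pq: "p = (x, y)" "q = (x', y')" by (metis surj_pair)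
  define i j where "i = min x y mod (l + 1)" and "j = min x' y' mod (l + 1)"
  have le: "i \<le> min x y" "j \<le> min x' y'" "i \<le> l" "j \<le> l"
    unfolding i_def j_def using mod_less_divisor[of "l + 1"]
    by (simp_all only: mod_less_eq_dividend) (simp_all add: less_Suc_eq_le)
  have "x - i = x' - j" "y - i = y' - j"
    using assms(2) by (simp_all add: pq align_def i_def j_def)
  with le have "x + j = x' + i" "y + j = y' + i" by linarith+
  with le show ?thesis
    unfolding pq l_diagonal_from_def fst_conv snd_conv l_diagonals_intersect_iff[OF assms(1)] by blast
qed

text \<open>A common point gives \<open>min x y + i = min x' y' + j\<close>. Modulo l + 1 both
  minima vanish, and i, j \<le> l then forces i = j.\<close>

lemma aligned_intersect_imp_eq:
  assumes "l > 0" and "(l + 1) dvd min x y" and "(l + 1) dvd min x' y'"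
    and "l_diagonals_intersect (l_diagonal l x y) (l_diagonal l x' y')"
  shows "(x, y) = (x', y')"
proof -
  obtain i j where ij: "i \<le> l" "j \<le> l" "x + i = x' + j" "y + i = y' + j"
    using assms(4) l_diagonals_intersect_iff[OF assms(1)] by blast
  then have "min x y + i = min x' y' + j" by linarith
  then have "(min x y + i) mod (l + 1) = (min x' y' + j) mod (l + 1)" by simp
  then have "i mod (l + 1) = j mod (l + 1)"
    using assms(2,3) by (simp only: mod_add_left_eq[symmetric, of "min _ _"] dvd_imp_mod_0 add_0)
  with ij(1,2) have "i = j" by simp
  with ij show ?thesis by simp
qed

lemma max_diagonals_eq_card_aligned_starts:
  assumes "l > 0"
  shows "max_diagonals l n = card (aligned_starts l n)"
  unfolding max_diagonals_def
proof (rule Max_eqI)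
  have "non_intersecting_families l n \<subseteq> Pow (l_diagonals l n)"
    by (auto simp: non_intersecting_families_def)
  then have "finite (non_intersecting_families l n)"
    by (rule finite_subset) (simp add: l_diagonals_eq_image finite_starts)
  then show "finite (card ` non_intersecting_families l n)" by simp
next
  fix k assume "k \<in> card ` non_intersecting_families l n"
  then obtain F where k: "k = card F" and F: "F \<subseteq> l_diagonal_from l ` starts l n"
    and disj: "pairwise (\<lambda>P Q. \<not> l_diagonals_intersect P Q) F"
    by (auto simp: non_intersecting_families_def l_diagonals_eq_image)
  \<comment> \<open>Choosing one start for each member of F gives card F = card S.\<close>
  from F obtain S where S: "S \<subseteq> starts l n" "inj_on (l_diagonal_from l) S"
    "F = l_diagonal_from l ` S"
    unfolding subset_image_inj by blast
  have "inj_on (align l) S"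
  proof (rule inj_onI)
    fix p q assume pq: "p \<in> S" "q \<in> S" "align l p = align l q"
    then have "l_diagonals_intersect (l_diagonal_from l p) (l_diagonal_from l q)"
      by (intro align_eq_imp_intersect[OF assms])
    moreover have "l_diagonal_from l p \<in> F" "l_diagonal_from l q \<in> F"
      using pq(1,2) by (simp_all add: S(3))
    \<comment> \<open>Only distinct members of F are kept from intersecting, so intersecting members
      are equal.\<close>
    ultimately have "l_diagonal_from l p = l_diagonal_from l q"
      using pairwiseD[OF disj] by metis
    then show "p = q" using inj_onD[OF S(2)] pq(1,2) by metis
  qed
  then have "card S \<le> card (aligned_starts l n)"
    by (rule card_inj_on_le) (use S(1) align_in_aligned_starts finite_aligned_starts in auto)
  then show "k \<le> card (aligned_starts l n)"
    using k S by (simp add: card_image)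
next
  let ?F = "l_diagonal_from l ` aligned_starts l n"
  have eq: "p = q" if "p \<in> aligned_starts l n" "q \<in> aligned_starts l n"
    "l_diagonals_intersect (l_diagonal_from l p) (l_diagonal_from l q)" for p q
    using that aligned_intersect_imp_eq[OF assms]
    by (cases p; cases q) (auto simp: aligned_starts_def l_diagonal_from_def)
  \<comment> \<open>Since a diagonal meets itself, equal diagonals have intersecting, hence by
    \<open>eq\<close> equal, aligned starts.\<close>
  have self: "l_diagonals_intersect (l_diagonal_from l p) (l_diagonal_from l p)" for p
    by (rule align_eq_imp_intersect[OF assms refl])
  have "inj_on (l_diagonal_from l) (aligned_starts l n)"
    by (rule inj_onI) (metis eq self)
  then have "card ?F = card (aligned_starts l n)" by (rule card_image)
  moreover have "pairwise (\<lambda>P Q. \<not> l_diagonals_intersect P Q) ?F"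
    unfolding pairwise_def using eq by blast
  then have "?F \<in> non_intersecting_families l n"
    by (auto simp: non_intersecting_families_def l_diagonals_eq_image aligned_starts_def)
  ultimately show "card (aligned_starts l n) \<in> card ` non_intersecting_families l n"
    by (metis imageI)
qed

text \<open>The set is an L with corner (a, a). The corner is counted in the vertical arm only,
  hence the half-open interval in the other.\<close>

lemma card_pairs_with_min:
  fixes a b :: nat
  assumes "a \<le> b"
  shows "card {(x, y). x \<le> b \<and> y \<le> b \<and> min x y = a} = 2 * (b - a) + 1"
proof -
  have "{(x, y). x \<le> b \<and> y \<le> b \<and> min x y = a} = {a} \<times> {a..b} \<union> {a<..b} \<times> {a}"
    using assms by (auto simp: min_def split: if_splits)
  moreover have "card ({a} \<times> {a..b} \<union> {a<..b} \<times> {a}) = card ({a} \<times> {a..b}) + card ({a<..b} \<times> {a})"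
    by (rule card_Un_disjoint) auto
  ultimately show ?thesis
    using assms by (simp add: card_cartesian_product)
qed

lemma card_aligned_starts:
  fixes l m :: nat
  assumes "l > 0" and "m > 0"
  defines "n \<equiv> (l + 1) * m"
  shows "real (card (aligned_starts l n)) = real m * (real n - real l + 2)"
proof -
  define A where "A j = {(x, y). x \<le> n - l \<and> y \<le> n - l \<and> min x y = (l + 1) * j}" for j
  have "l \<le> n" using assms(2) by (cases m) (simp_all add: n_def)
  \<comment> \<open>Layer \<open>A j\<close> has its corner at ((l + 1) j, (l + 1) j), so it fits
    iff this corner is a start. For j \<ge> m the corner is already at n or beyond, leaving no room
    for l > 0 more steps.\<close>
  have le: "(l + 1) * j + l \<le> n \<longleftrightarrow> j < m" for j
  proof
    assume *: "(l + 1) * j + l \<le> n"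
    show "j < m"
    proof (rule ccontr)
      assume "\<not> j < m"
      then have "n \<le> (l + 1) * j" unfolding n_def by (intro mult_le_mono2) simp
      with * \<open>l > 0\<close> show False by linarith
    qed
  next
    assume "j < m"
    then have "(l + 1) * (j + 1) \<le> n" unfolding n_def by (intro mult_le_mono2) simp
    then show "(l + 1) * j + l \<le> n" by simp
  qed
  have "aligned_starts l n = (\<Union>j<m. A j)"
  proof (intro set_eqI iffI)
    fix p assume "p \<in> aligned_starts l n"
    then obtain x y j where p: "p = (x, y)" "x + l \<le> n" "y + l \<le> n" "min x y = (l + 1) * j"
      by (auto simp: aligned_starts_def starts_def dvd_def)
    then have "(l + 1) * j + l \<le> n" by linarith
    then have "j < m" by (simp only: le)
    moreover have "p \<in> A j" using p by (auto simp: A_def)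
    ultimately show "p \<in> (\<Union>j<m. A j)" by blast
  next
    fix p assume "p \<in> (\<Union>j<m. A j)"
    then obtain x y j where p: "p = (x, y)" "x \<le> n - l" "y \<le> n - l" "min x y = (l + 1) * j"
      by (auto simp: A_def)
    then have "(l + 1) dvd min x y" by (metis dvd_triv_left)
    moreover have "x + l \<le> n" "y + l \<le> n" using p(2,3) \<open>l \<le> n\<close> by linarith+
    ultimately show "p \<in> aligned_starts l n"
      by (simp add: p(1) aligned_starts_def starts_def)
  qed
  moreover have "card (\<Union>j<m. A j) = (\<Sum>j<m. card (A j))"
  proof (rule card_UN_disjoint)
    show "\<forall>j\<in>{..<m}. finite (A j)"
      by (auto simp: A_def intro: finite_subset[of _ "{..n} \<times> {..n}"])
    have "j = k" if "p \<in> A j" "p \<in> A k" for p j k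
    proof -
      have "(l + 1) * j = (l + 1) * k" using that by (auto simp only: A_def)
      then show ?thesis by (metis Suc_eq_plus1 Suc_mult_cancel1)
    qed
    then show "\<forall>i\<in>{..<m}. \<forall>j\<in>{..<m}. i \<noteq> j \<longrightarrow> A i \<inter> A j = {}" by blast
  qed simp
  moreover have "real (card (A j)) = 2 * (real n - real l - (real l + 1) * real j) + 1" if "j < m" for j
  proof -
    have "(l + 1) * j + l \<le> n" using that le by blast
    then have *: "(l + 1) * j \<le> n - l" by linarith
    have "card (A j) = 2 * (n - l - (l + 1) * j) + 1"
      using card_pairs_with_min[OF *] by (simp only: A_def)
    moreover have "real (n - l - (l + 1) * j) = real n - real l - real ((l + 1) * j)"
      using * \<open>l \<le> n\<close> by (simp only: of_nat_diff)
    ultimately show ?thesis by (simp only: of_nat_add of_nat_mult of_nat_1 of_nat_numeral)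
  qed
  ultimately have "real (card (aligned_starts l n)) =
      (\<Sum>j<m. 2 * (real n - real l - (real l + 1) * real j) + 1)"
    by simp
  \<comment> \<open>An arithmetic series: n stays fixed while the induction varies m. Only
    afterwards is n = (l + 1) m substituted.\<close>
  also have "\<dots> = real m * (2 * real n - 2 * real l + 1 - (real l + 1) * (real m - 1))"
    by (induction m) (simp_all add: algebra_simps)
  also have "\<dots> = real m * (real n - real l + 2)"
    by (simp add: n_def algebra_simps)
  finally show ?thesis .
qed

theorem mainTheorem1:
  fixes l n :: nat
  assumes "l > 0" and "n > 0" and "(l + 1) dvd n"
  shows "real (max_diagonals l n) = (real n ^ 2 - real n * (real l - 2)) / (real l + 1)"
proof -
  obtain m where n: "n = (l + 1) * m" using assms(3) by blast
  with assms(2) have "m > 0" by (cases m) simp_all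
  have "real (max_diagonals l n) = real m * (real n - real l + 2)"
    using max_diagonals_eq_card_aligned_starts[OF assms(1)] card_aligned_starts[OF assms(1) \<open>m > 0\<close>]
    by (simp add: n)
  \<comment> \<open>Expanding the fraction by l + 1 turns the factor m into n.\<close>
  also have "\<dots> = (real n ^ 2 - real n * (real l - 2)) / (real l + 1)"
    by (simp add: n field_simps power2_eq_square)
  finally show ?thesis .
qed

end
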